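(* Let $\mathbf{W}=(W_j)_{j\in[p]}$ be the knockoff statistic computed from a single draw of knockoff variables, and assume that for all $j,j'\in[p]$ with $j\neq j'$, $$\mathbb{P}(W_j=W_{j'},\ W_j\ne0,\ W_{j'}\ne0)=0,$$ that is, the non-zero statistics are distinct with probability $1$. Let $\alpha\in(0,1)$. Then the single-bootstrap version ($B=1$) of aggregation of multiple knockoffs, with $\gamma=1$ and the Benjamini–Hochberg (BH) step-up procedure at level $\alpha$ for the FDR threshold, is equivalent to the original knockoff inference procedure at level $\alpha$: computed from the same $\mathbf{W}$, the two procedures select the same set of variables with probability $1$.
   Context: $[p]=\{1,\dots,p\}$. A knockoff statistic is a real random vector $\mathbf{W}=(W_j)_{j\in[p]}=f(\mathbf{X},\tilde{\mathbf{X}},\mathbf{y})$ computed from a design $\mathbf{X}\in\mathbb{R}^{n\times p}$, a knockoff copy $\tilde{\mathbf{X}}\in\mathbb{R}^{n\times p}$ and a response $\mathbf{y}\in\mathbb{R}^n$, such that for every $\mathcal{K}\subset[p]$, swapping the $j$-th columns of $\mathbf{X}$ and $\tilde{\mathbf{X}}$ for all $j\in\mathcal{K}$ changes $W_j$ into $-W_j$ for $j\in\mathcal{K}$ and leaves $W_j$ unchanged for $j\notin\mathcal{K}$. Both procedures below are functions of $\mathbf{W}$ only. Original (vanilla) knockoff inference at level $\alpha$: let $$\tau_+=\min\Bigl\{t\in\{|W_j|:j\in[p]\}\setminus\{0\}:\ \frac{1+\#\{j:W_j\le -t\}}{\#\{j:W_j\ge t\}\vee1}\le\alpha\Bigr\}$$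 ($\tau_+=+\infty$ if no such $t$ exists) and select $\{j\in[p]:W_j\ge\tau_+\}$. Aggregation of multiple knockoffs (AKO) with BH step-up: from each of $B$ knockoff draws with statistic $\mathbf{W}^{(b)}$ compute the intermediate p-values $$\pi_j^{(b)}=\begin{cases}\dfrac{1+\#\{k\in[p]:W^{(b)}_k\le -W^{(b)}_j\}}{p}&\text{if }W^{(b)}_j>0,\\ 1&\text{if }W^{(b)}_j\le0,\end{cases}$$ aggregate them as $\bar\pi_j=\min\{1,q_\gamma(\{\pi^{(b)}_j:b\in[B]\})/\gamma\}$, with $q_\gamma$ the empirical $\gamma$-quantile (so for $B=1$, $\gamma=1$, $\bar\pi_j=\pi_j^{(1)}$), order $\bar\pi_{(1)}\le\dots\le\bar\pi_{(p)}$, let $\widehat k_{BH}=\max\{k\in[p]:\bar\pi_{(k)}\le k\alpha/p\}$ and select $\{j\in[p]:\bar\pi_j\le\bar\pi_{(\widehat k_{BH})}\}$ (the empty set if no such $k$ exists). *)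

theory Defs
  imports "HOL-Probability.Probability"
begin

section \<open>Knockoff statistics\<close>

text \<open>The index set \<open>[p]\<close> is the finite type \<open>'p\<close>, so \<open>p = CARD('p)\<close>; an \<open>n \<times> p\<close> design is a
  \<open>real ^ 'p ^ 'n\<close>, whose entry in row \<open>i\<close> and column \<open>j\<close> is \<open>A $ i $ j\<close>.\<close>

definition replace_columns ::
    "'p set \<Rightarrow> real ^ 'p ^ 'n \<Rightarrow> real ^ 'p ^ 'n \<Rightarrow> real ^ 'p ^ 'n" where
  "replace_columns K A B = (\<chi> i j. if j \<in> K then B $ i $ j else A $ i $ j)"

text \<open>Swapping the columns in \<open>K\<close> turns the pair \<open>(A, B)\<close> into
  \<open>(replace_columns K A B, replace_columns K B A)\<close>.\<close>

definition flips_sign ::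
    "(real ^ 'p ^ 'n \<Rightarrow> real ^ 'p ^ 'n \<Rightarrow> real ^ 'n \<Rightarrow> real ^ 'p) \<Rightarrow> bool" where
  "flips_sign f \<longleftrightarrow>
     (\<forall>K A B v j. f (replace_columns K A B) (replace_columns K B A) v $ j =
        (if j \<in> K then - (f A B v $ j) else f A B v $ j))"

definition knockoff_statistic ::
    "'w measure \<Rightarrow> ('w \<Rightarrow> real ^ 'p::finite ^ 'n::finite) \<Rightarrow> ('w \<Rightarrow> real ^ 'p ^ 'n) \<Rightarrow>
     ('w \<Rightarrow> real ^ 'n) \<Rightarrow> ('w \<Rightarrow> real ^ 'p) \<Rightarrow> bool" where
  "knockoff_statistic M X Xk y W \<longleftrightarrow>
     X \<in> borel_measurable M \<and> Xk \<in> borel_measurable M \<and> y \<in> borel_measurable M \<and>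
     W \<in> borel_measurable M \<and>
     (\<exists>f. flips_sign f \<and> (\<forall>\<omega>\<in>space M. W \<omega> = f (X \<omega>) (Xk \<omega>) (y \<omega>)))"


section \<open>Original knockoff inference\<close>

definition knockoff_thresholds :: "real \<Rightarrow> real ^ 'p::finite \<Rightarrow> real set" where
  "knockoff_thresholds \<alpha> W =
     {t \<in> range (\<lambda>j. \<bar>W $ j\<bar>) - {0}.
        (1 + real (card {j. W $ j \<le> - t})) / real (max (card {j. W $ j \<ge> t}) 1) \<le> \<alpha>}"

definition knockoff_tau :: "real \<Rightarrow> real ^ 'p::finite \<Rightarrow> ereal" where
  "knockoff_tau \<alpha> W =
     (if knockoff_thresholds \<alpha> W = {} then \<infinity> else ereal (Min (knockoff_thresholds \<alpha> W)))"

definition knockoff_selection :: "real \<Rightarrow> real ^ 'p::finite \<Rightarrow> 'p set" where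
  "knockoff_selection \<alpha> W = {j. ereal (W $ j) \<ge> knockoff_tau \<alpha> W}"


section \<open>Aggregation of multiple knockoffs\<close>

definition intermediate_pvalue :: "real ^ 'p::finite \<Rightarrow> 'p \<Rightarrow> real" where
  "intermediate_pvalue W j =
     (if W $ j > 0 then (1 + real (card {k. W $ k \<le> - (W $ j)})) / real CARD('p) else 1)"

text \<open>The generalised inverse at \<open>\<gamma>\<close> of the empirical distribution function of the sample \<open>xs\<close>
  (for a non-empty sample and \<open>0 < \<gamma> \<le> 1\<close>).\<close>

definition empirical_quantile :: "real \<Rightarrow> real list \<Rightarrow> real" where
  "empirical_quantile \<gamma> xs =
     Inf {t. real (length (filter (\<lambda>x. x \<le> t) xs)) / real (length xs) \<ge> \<gamma>}"

text \<open>The list \<open>Ws\<close> holds the statistics of the \<open>B = length Ws\<close> knockoff draws.\<close>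

definition aggregated_pvalue :: "real \<Rightarrow> (real ^ 'p::finite) list \<Rightarrow> 'p \<Rightarrow> real" where
  "aggregated_pvalue \<gamma> Ws j =
     min 1 (empirical_quantile \<gamma> (map (\<lambda>W. intermediate_pvalue W j) Ws) / \<gamma>)"

text \<open>The \<open>k\<close>-th smallest value, counted with multiplicity and from \<open>k = 1\<close>.\<close>

definition order_statistic :: "('p::finite \<Rightarrow> real) \<Rightarrow> nat \<Rightarrow> real" where
  "order_statistic x k = sorted_list_of_multiset (image_mset x (mset_set UNIV)) ! (k - 1)"

definition bh_indices :: "real \<Rightarrow> ('p::finite \<Rightarrow> real) \<Rightarrow> nat set" where
  "bh_indices \<alpha> x =
     {k \<in> {1..CARD('p)}. order_statistic x k \<le> real k * \<alpha> / real CARD('p)}"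

definition bh_selection :: "real \<Rightarrow> ('p::finite \<Rightarrow> real) \<Rightarrow> 'p set" where
  "bh_selection \<alpha> x =
     (if bh_indices \<alpha> x = {} then {} else {j. x j \<le> order_statistic x (Max (bh_indices \<alpha> x))})"

definition ako_bh_selection :: "real \<Rightarrow> real \<Rightarrow> (real ^ 'p::finite) list \<Rightarrow> 'p set" where
  "ako_bh_selection \<alpha> \<gamma> Ws = bh_selection \<alpha> (aggregated_pvalue \<gamma> Ws)"

end

theory Submission imports Defs begin

text \<open>BH selects the \<open>j\<close> with \<open>x\<^sub>j \<le> x\<^sub>i\<close> for some \<open>i\<close> satisfying
  \<open>x\<^sub>i \<le> \<alpha> #{k. x\<^sub>k \<le> x\<^sub>i} / p\<close>. Since \<open>\<alpha> < 1\<close>, only p-values of positive statistics can satisfy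
  this, and these decrease in the statistic. Hence \<open>{k. x\<^sub>k \<le> x\<^sub>i}\<close> is an upper level set
  \<open>{k. W\<^sub>k \<ge> t}\<close>, where \<open>t\<close> is the smallest positive statistic in it, and the BH condition at \<open>i\<close> is
  the knockoff condition at \<open>t\<close>. Conversely, a threshold \<open>t\<close> (which may come from a negative
  statistic) can be raised to the smallest \<open>W\<^sub>i \<ge> t\<close> without changing the selected set or
  enlarging \<open>#{k. W\<^sub>k \<le> - t}\<close>.\<close>

text \<open>The entries at most \<open>c\<close> form a prefix of a sorted list, and the filter
  measures its length. Indices start at 0, hence the strict inequality.\<close>

lemma sorted_nth_le_iff:
  fixes xs :: "'a::linorder list"
  assumes "sorted xs" "k < length xs"
  shows "xs ! k \<le> c \<longleftrightarrow> k < length (filter (\<lambda>v. v \<le> c) xs)"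
  using assms
proof (induction xs arbitrary: k)
  case Nil
  then show ?case by simp
next
  case (Cons a xs)
  show ?case
  proof (cases "a \<le> c")
    case True
    with Cons show ?thesis by (cases k) auto
  next
    case False
    with Cons.prems have gt: "\<forall>v \<in> set (a # xs). c < v" by auto
    then have "filter (\<lambda>v. v \<le> c) (a # xs) = []" by (force simp: filter_empty_conv)
    moreover have "c < (a # xs) ! k" using gt Cons.prems(2) nth_mem by blast
    ultimately show ?thesis by simp
  qed
qed

lemma length_order_list [simp]:
  "length (sorted_list_of_multiset (image_mset x (mset_set (UNIV :: 'p::finite set)))) = CARD('p)"
  by (metis mset_sorted_list_of_multiset size_image_mset size_mset size_mset_set)

lemma order_statistic_le_iff:
  fixes x :: "'p::finite \<Rightarrow> real"
  assumes "1 \<le> k" "k \<le> CARD('p)"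
  shows "order_statistic x k \<le> c \<longleftrightarrow> k \<le> card {j. x j \<le> c}"
proof -
  let ?xs = "sorted_list_of_multiset (image_mset x (mset_set UNIV))"
  have "length (filter (\<lambda>v. v \<le> c) ?xs) = size (filter_mset (\<lambda>v. v \<le> c) (mset ?xs))"
    by (metis mset_filter size_mset)
  also have "\<dots> = card {j. x j \<le> c}"
    by (simp add: filter_mset_image_mset)
  finally show ?thesis
    using assms sorted_nth_le_iff[of ?xs "k - 1" c]
    by (auto simp: order_statistic_def)
qed

lemma order_statistic_in_range:
  fixes x :: "'p::finite \<Rightarrow> real"
  assumes "1 \<le> k" "k \<le> CARD('p)"
  shows "order_statistic x k \<in> range x"
proof -
  let ?xs = "sorted_list_of_multiset (image_mset x (mset_set UNIV))"
  have "?xs ! (k - 1) \<in> set ?xs" using assms by (intro nth_mem) simp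
  then show ?thesis by (simp add: order_statistic_def)
qed

text \<open>This removes order statistics and the maximum: the value at the largest BH index is
  attained by some \<open>x i\<close>, and conversely the rank of any \<open>x i\<close> that meets
  the bound is itself a BH index.\<close>

lemma mem_bh_selection_iff:
  fixes x :: "'p::finite \<Rightarrow> real"
  assumes "0 \<le> \<alpha>"
  shows "j \<in> bh_selection \<alpha> x \<longleftrightarrow>
    (\<exists>i. x j \<le> x i \<and> x i \<le> real (card {k. x k \<le> x i}) * \<alpha> / real CARD('p))"
    (is "_ \<longleftrightarrow> ?R")
proof
  have fin: "finite (bh_indices \<alpha> x)" unfolding bh_indices_def by simp
  {
    assume sel: "j \<in> bh_selection \<alpha> x"
    define K where "K = Max (bh_indices \<alpha> x)"
    from sel have ne: "bh_indices \<alpha> x \<noteq> {}" and j: "x j \<le> order_statistic x K"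
      by (auto simp: bh_selection_def K_def split: if_splits)
    have "K \<in> bh_indices \<alpha> x" unfolding K_def using fin ne by (rule Max_in)
    then have K: "1 \<le> K" "K \<le> CARD('p)"
      and le: "order_statistic x K \<le> real K * \<alpha> / real CARD('p)"
      by (auto simp: bh_indices_def)
    obtain i where i: "order_statistic x K = x i"
      using order_statistic_in_range[OF K] by blast
    \<comment> \<open>With ties the count may exceed \<open>K\<close>; this only relaxes the bound,
      as 0 \<le> \<alpha>.\<close>
    have "K \<le> card {k. x k \<le> x i}"
      using order_statistic_le_iff[OF K] i by (metis order_refl)
    then have "real K * \<alpha> / real CARD('p) \<le> real (card {k. x k \<le> x i}) * \<alpha> / real CARD('p)"
      using assms by (intro divide_right_mono mult_right_mono) auto
    with i le j show ?R by force
  }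
  {
    assume ?R
    then obtain i where ji: "x j \<le> x i"
      and i: "x i \<le> real (card {k. x k \<le> x i}) * \<alpha> / real CARD('p)" by blast
    define m where "m = card {k. x k \<le> x i}"
    have "m > 0" unfolding m_def by (auto simp: card_gt_0_iff)
    then have m: "1 \<le> m" "m \<le> CARD('p)" by (auto simp: m_def intro: card_mono)
    have "order_statistic x m \<le> x i" using order_statistic_le_iff[OF m] m_def by simp
    with i m have mem: "m \<in> bh_indices \<alpha> x" by (simp add: bh_indices_def m_def)
    define K where "K = Max (bh_indices \<alpha> x)"
    have "K \<in> bh_indices \<alpha> x" unfolding K_def using fin mem by (intro Max_in) auto
    then have K: "1 \<le> K" "K \<le> CARD('p)" by (auto simp: bh_indices_def)
    have "m \<le> K" unfolding K_def using fin mem by simp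
    \<comment> \<open>Otherwise \<open>i\<close> is missing from the indices whose value is at most
      the \<open>K\<close>-th order statistic. These would number fewer than \<open>m\<close>, yet
      there are at least \<open>K\<close> \<ge> \<open>m\<close> of them.\<close>
    have "x i \<le> order_statistic x K"
    proof (rule ccontr)
      assume neg: "\<not> ?thesis"
      have "K \<le> card {k. x k \<le> order_statistic x K}"
        using order_statistic_le_iff[OF K] by blast
      also have "\<dots> < m"
        unfolding m_def using neg by (intro psubset_card_mono) auto
      finally show False using \<open>m \<le> K\<close> by simp
    qed
    with ji mem show "j \<in> bh_selection \<alpha> x" by (auto simp: bh_selection_def K_def)
  }
qed

text \<open>A finite minimum lies below a bound iff some element does; if there is no threshold,
  \<tau> is infinite and nothing is selected.\<close>

lemma mem_knockoff_selection_iff: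
  "j \<in> knockoff_selection \<alpha> W \<longleftrightarrow> (\<exists>t \<in> knockoff_thresholds \<alpha> W. t \<le> W $ j)"
proof -
  have "finite (knockoff_thresholds \<alpha> W)" unfolding knockoff_thresholds_def by simp
  then show ?thesis by (auto simp: knockoff_selection_def knockoff_tau_def Min_le_iff)
qed

lemma empirical_quantile_singleton [simp]: "empirical_quantile 1 [a] = a"
proof -
  have "{t. real (length (filter (\<lambda>x. x \<le> t) [a])) / real (length [a]) \<ge> 1} = {a..}"
    by auto
  then show ?thesis unfolding empirical_quantile_def by simp
qed

text \<open>A positive statistic does not count itself, so the added 1 keeps the numerator within p.
  This makes the truncation at 1 in \<open>aggregated_pvalue\<close> harmless.\<close>

lemma intermediate_pvalue_le_1: "intermediate_pvalue W j \<le> 1"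
  for W :: "real ^ 'p::finite"
proof (cases "W $ j > 0")
  case True
  then have "j \<notin> {k. W $ k \<le> - (W $ j)}" by simp
  then have "card {k. W $ k \<le> - (W $ j)} < CARD('p)"
    by (metis UNIV_I finite psubsetI psubset_card_mono subset_UNIV)
  then show ?thesis by (simp add: intermediate_pvalue_def)
qed (simp add: intermediate_pvalue_def)

lemma aggregated_pvalue_single: "aggregated_pvalue 1 [W] = intermediate_pvalue W"
  by (rule ext) (simp add: aggregated_pvalue_def intermediate_pvalue_le_1)

text \<open>Raising a positive statistic shrinks the set of indices at or below its
  negative.\<close>

lemma intermediate_pvalue_antimono:
  assumes "0 < W $ i" "W $ i \<le> W $ k"
  shows "intermediate_pvalue W k \<le> intermediate_pvalue W i"
  using assms
  by (auto simp: intermediate_pvalue_def intro!: divide_right_mono card_mono)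

lemma ako_bh_selection_single_eq:
  fixes W :: "real ^ 'p::finite"
  assumes \<alpha>: "0 < \<alpha>" "\<alpha> < 1"
  shows "ako_bh_selection \<alpha> 1 [W] = knockoff_selection \<alpha> W"
proof (rule set_eqI)
  fix j
  let ?q = "intermediate_pvalue W" and ?p = "real CARD('p)"
  have "(\<exists>i. ?q j \<le> ?q i \<and> ?q i \<le> real (card {k. ?q k \<le> ?q i}) * \<alpha> / ?p) \<longleftrightarrow>
    (\<exists>t \<in> knockoff_thresholds \<alpha> W. t \<le> W $ j)"
  proof
    assume "\<exists>i. ?q j \<le> ?q i \<and> ?q i \<le> real (card {k. ?q k \<le> ?q i}) * \<alpha> / ?p"
    then obtain i where ji: "?q j \<le> ?q i"
      and i: "?q i \<le> real (card {k. ?q k \<le> ?q i}) * \<alpha> / ?p" by blast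
    define S where "S = {k. ?q k \<le> ?q i}"
    \<comment> \<open>As \<alpha> < 1, the BH bound stays below 1, which keeps the default p-value 1
      of nonpositive statistics out of \<open>S\<close>.\<close>
    have "real (card S) * \<alpha> \<le> ?p * \<alpha>"
      using \<alpha> by (intro mult_right_mono) (auto intro: card_mono)
    also have "\<dots> < ?p" using \<alpha> by simp
    finally have "real (card S) * \<alpha> / ?p < 1" by simp
    with i have "?q i < 1" unfolding S_def by (rule le_less_trans)
    then have pos: "W $ k > 0" if "k \<in> S" for k
      using that by (auto simp: S_def intermediate_pvalue_def split: if_splits)
    have "j \<in> S" using ji by (simp add: S_def)
    then obtain m where m: "m \<in> S" and min: "\<And>k. k \<in> S \<Longrightarrow> W $ m \<le> W $ k"
      using arg_min_if_finite(1)[of S "\<lambda>k. W $ k"] arg_min_least[of S _ "\<lambda>k. W $ k"]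
      by (metis empty_iff finite)
    have S: "S = {k. W $ m \<le> W $ k}"
    proof (intro set_eqI iffI CollectI)
      fix k assume "k \<in> {k. W $ m \<le> W $ k}"
      then have "?q k \<le> ?q m" using pos[OF m] by (auto intro: intermediate_pvalue_antimono)
      also have "\<dots> \<le> ?q i" using m by (simp add: S_def)
      finally show "k \<in> S" by (simp add: S_def)
    qed (rule min)
    \<comment> \<open>The bound passes from \<open>i\<close> to \<open>m\<close> because
      \<open>m\<close> lies in \<open>S\<close>; clearing the denominator p then gives the knockoff
      inequality.\<close>
    have "?q m \<le> real (card S) * \<alpha> / ?p" using m i by (simp add: S_def)
    then have "1 + real (card {k. W $ k \<le> - (W $ m)}) \<le> real (card S) * \<alpha>"
      using pos[OF m] by (simp add: intermediate_pvalue_def divide_le_cancel)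
    \<comment> \<open>Nonemptiness lets the maximum with 1 in the knockoff ratio drop out.\<close>
    moreover have "card S \<ge> 1" using m by (simp add: Suc_le_eq card_gt_0_iff) blast
    ultimately have "W $ m \<in> knockoff_thresholds \<alpha> W"
      using pos[OF m]
      by (auto simp: knockoff_thresholds_def S[symmetric] max_absorb1 field_simps
          intro!: image_eqI[of _ _ m])
    then show "\<exists>t \<in> knockoff_thresholds \<alpha> W. t \<le> W $ j" using min[OF \<open>j \<in> S\<close>] by blast
  next
    assume "\<exists>t \<in> knockoff_thresholds \<alpha> W. t \<le> W $ j"
    then obtain t where t: "t \<in> knockoff_thresholds \<alpha> W" and tj: "t \<le> W $ j" by blast
    define S where "S = {k. t \<le> W $ k}"
    have "t > 0" using t by (auto simp: knockoff_thresholds_def)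
    have "j \<in> S" using tj by (simp add: S_def)
    then have "card S \<ge> 1" by (simp add: Suc_le_eq card_gt_0_iff) blast
    with t have le: "1 + real (card {k. W $ k \<le> - t}) \<le> real (card S) * \<alpha>"
      by (simp add: knockoff_thresholds_def S_def[symmetric] max_absorb1 field_simps)
    from \<open>j \<in> S\<close> obtain m where m: "m \<in> S" and min: "\<And>k. k \<in> S \<Longrightarrow> W $ m \<le> W $ k"
      using arg_min_if_finite(1)[of S "\<lambda>k. W $ k"] arg_min_least[of S _ "\<lambda>k. W $ k"]
      by (metis empty_iff finite)
    have pos: "W $ m > 0" using m \<open>t > 0\<close> by (simp add: S_def)
    \<comment> \<open>Inclusion suffices here: a larger count only weakens the BH condition at
      \<open>m\<close>.\<close>
    have sub: "S \<subseteq> {k. ?q k \<le> ?q m}"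
      using min pos by (auto intro: intermediate_pvalue_antimono)
    have "card {k. W $ k \<le> - (W $ m)} \<le> card {k. W $ k \<le> - t}"
      using m by (intro card_mono) (auto simp: S_def)
    with le have "1 + real (card {k. W $ k \<le> - (W $ m)}) \<le> real (card S) * \<alpha>" by linarith
    also have "\<dots> \<le> real (card {k. ?q k \<le> ?q m}) * \<alpha>"
      using sub \<alpha> by (intro mult_right_mono) (auto intro: card_mono)
    finally have "?q m \<le> real (card {k. ?q k \<le> ?q m}) * \<alpha> / ?p"
      unfolding intermediate_pvalue_def[of W m] using pos
      by (simp add: divide_le_cancel)
    moreover have "?q j \<le> ?q m" using sub \<open>j \<in> S\<close> by blast
    ultimately show "\<exists>i. ?q j \<le> ?q i \<and> ?q i \<le> real (card {k. ?q k \<le> ?q i}) * \<alpha> / ?p" by blast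
  qed
  then show "j \<in> ako_bh_selection \<alpha> 1 [W] \<longleftrightarrow> j \<in> knockoff_selection \<alpha> W"
    using \<alpha> by (simp add: ako_bh_selection_def aggregated_pvalue_single mem_bh_selection_iff
        mem_knockoff_selection_iff)
qed

theorem proposition1:
  fixes M :: "'w measure"
    and X Xk :: "'w \<Rightarrow> real ^ 'p::finite ^ 'n::finite"
    and y :: "'w \<Rightarrow> real ^ 'n"
    and W :: "'w \<Rightarrow> real ^ 'p"
    and \<alpha> :: real
  assumes "prob_space M"
    and "knockoff_statistic M X Xk y W"
    and "\<And>j j'. j \<noteq> j' \<Longrightarrow>
      measure M {\<omega> \<in> space M. W \<omega> $ j = W \<omega> $ j' \<and> W \<omega> $ j \<noteq> 0 \<and> W \<omega> $ j' \<noteq> 0} = 0"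
    and "0 < \<alpha>" and "\<alpha> < 1"
  shows "AE \<omega> in M. ako_bh_selection \<alpha> 1 [W \<omega>] = knockoff_selection \<alpha> (W \<omega>)"
proof -
  have "ako_bh_selection \<alpha> 1 [W \<omega>] = knockoff_selection \<alpha> (W \<omega>)" for \<omega>
    using ako_bh_selection_single_eq[OF assms(4,5)] .
  then show ?thesis by simp
qed

end
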